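(* Let $\mathcal H$ be a complex Hilbert space and let $T$ be a bounded operator on $\mathcal H$ with $W(T)\subset\mathcal S_{\pi/4}=\{re^{i\theta}:r\ge0,\ |\theta|\le\pi/4\}$. Put $$w=(T^2-I)(T^2+I)^{-1},\qquad \mathsf X=w^2,$$ and, for a unit vector $\xi\in\mathcal H$, put $$b=\|\mathsf X\xi\|^2,\qquad q=\langle\mathsf X\xi,\xi\rangle .$$ Then $$\|h_c(w)\|\le\sqrt2\qquad\text{for all }c\in\mathbb D$$ holds if and only if, for every unit vector $\xi$, $$|q|^2\le(2-b)(2b-1)\quad\text{whenever } b>1 .$$ Equivalently, the latter condition is: for every unit vector $\xi$ with $\|\mathsf X\xi\|>1$, $$\|\mathsf X\xi-q\xi\|^2\ge2\bigl(\|\mathsf X\xi\|^2-1\bigr)^2 .$$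
   Context: $W(T)=\{\langle Tx,x\rangle:\|x\|=1\}$ is the numerical range, $\mathbb D$ is the open unit disk, and for $c\in\mathbb D$, $h_c(w)=\frac{w^2+\bar c}{1+cw^2}$, i.e. $h_c(w)=(w^2+\bar cI)(I+cw^2)^{-1}$. *)

theory Defs
  imports "HOL-Analysis.Analysis"
begin

class complex_vector = real_vector +
  fixes scaleC :: "complex \<Rightarrow> 'a \<Rightarrow> 'a"  (infixr \<open>*\<^sub>C\<close> 75)
  assumes scaleC_add_right: "c *\<^sub>C (x + y) = c *\<^sub>C x + c *\<^sub>C y"
    and scaleC_add_left: "(c + d) *\<^sub>C x = c *\<^sub>C x + d *\<^sub>C x"
    and scaleC_scaleC: "c *\<^sub>C d *\<^sub>C x = (c * d) *\<^sub>C x"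
    and scaleC_one: "1 *\<^sub>C x = x"
    and scaleR_scaleC: "scaleR r x = complex_of_real r *\<^sub>C x"

(* The inner product is linear in the first argument. Its positive definiteness
   follows from cinner_self and the norm axioms. *)
class complex_inner = complex_vector + real_normed_vector +
  fixes cinner :: "'a \<Rightarrow> 'a \<Rightarrow> complex"
  assumes cinner_commute: "cinner x y = cnj (cinner y x)"
    and cinner_add_left: "cinner (x + y) z = cinner x z + cinner y z"
    and cinner_scaleC_left: "cinner (c *\<^sub>C x) y = c * cinner x y"
    and cinner_self: "cinner x x = complex_of_real ((norm x)\<^sup>2)"

class chilbert_space = complex_inner + complete_space

definition bounded_clinear :: "('a::complex_inner \<Rightarrow> 'b::complex_inner) \<Rightarrow> bool" where
  "bounded_clinear T \<longleftrightarrow> bounded_linear T \<and> (\<forall>c x. T (c *\<^sub>C x) = c *\<^sub>C T x)"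

definition numerical_range :: "('a::complex_inner \<Rightarrow> 'a) \<Rightarrow> complex set" where
  "numerical_range T = {cinner (T x) x | x. norm x = 1}"

definition sector :: "real \<Rightarrow> complex set" where
  "sector \<alpha> = {complex_of_real r * cis \<theta> | r \<theta>. 0 \<le> r \<and> \<bar>\<theta>\<bar> \<le> \<alpha>}"

(* The operator (T^2 - I)(T^2 + I)^{-1}. Since inv is total, this is meaningful only
   when T^2 + I is bijective. That holds if T is bounded with numerical range in
   sector (pi/4): then the spectrum of T lies in this sector, so i and -i are in the
   resolvent set. *)
definition cayley_square :: "('a::complex_vector \<Rightarrow> 'a) \<Rightarrow> 'a \<Rightarrow> 'a" where
  "cayley_square T = (\<lambda>x. T (T x) - x) \<circ> inv (\<lambda>x. T (T x) + x)"

(* The operator h_c(w) = (w^2 + cnj c I)(I + c w^2)^{-1}. For w = cayley_square T with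
   T as above, the spectrum of w lies in the closed unit disc, so I + c w^2 is
   bijective for every c in the open unit disc. *)
definition h_op :: "complex \<Rightarrow> ('a::complex_vector \<Rightarrow> 'a) \<Rightarrow> 'a \<Rightarrow> 'a" where
  "h_op c w = (\<lambda>x. w (w x) + cnj c *\<^sub>C x) \<circ> inv (\<lambda>x. x + c *\<^sub>C w (w x))"

end

theory Submission
  imports Defs
begin

text \<open>
  Once \<open>I + c X\<close> is known to be invertible, the substitution \<open>y = (I + c X) x\<close> turns
  \<open>\<parallel>h\<^sub>c(w)\<parallel> \<le> \<surd>2\<close> into \<open>\<parallel>X \<xi> + cnj c \<xi>\<parallel>\<^sup>2 \<le> 2 \<parallel>\<xi> + c X \<xi>\<parallel>\<^sup>2\<close> for all unit vectors \<open>\<xi>\<close>.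
  Expanding both squares gives
  \<open>0 \<le> 2 - b + \<bar>c\<bar>\<^sup>2 (2 b - 1) + 2 Re (c q)\<close>, in which the operator enters only through the numbers
  \<open>b\<close> and \<open>q\<close> of the vector \<open>\<xi>\<close>. The quantifiers over \<open>c\<close> and \<open>\<xi>\<close> commute, so for each \<open>\<xi>\<close> one
  minimises over the disc. The best phase of \<open>c\<close> leaves the real quadratic
  \<open>2 - b - 2 r \<bar>q\<bar> + r\<^sup>2 (2 b - 1)\<close> on \<open>0 \<le> r < 1\<close>. Cauchy--Schwarz, \<open>\<bar>q\<bar>\<^sup>2 \<le> b\<close>, does two things:
  if \<open>b \<le> 1\<close>, it makes this nonnegative outright; if \<open>b > 1\<close>, it places the vertex
  \<open>\<bar>q\<bar> / (2 b - 1)\<close> inside the interval, so that the sharp condition is that the discriminant is not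
  positive, i.e. \<open>\<bar>q\<bar>\<^sup>2 \<le> (2 - b) (2 b - 1)\<close> (lemma \<open>quadratic_on_disc_iff\<close>). The
  form with the residual follows from \<open>\<parallel>X \<xi> - q \<xi>\<parallel>\<^sup>2 = b - \<bar>q\<bar>\<^sup>2\<close> and
  \<open>(2 - b) (2 b - 1) = b - 2 (b - 1)\<^sup>2\<close>.

  The analytic input is the invertibility of \<open>T\<^sup>2 + I\<close> and of \<open>I + c X\<close>. Writing \<open>c = - d\<^sup>2\<close>, the
  latter factors as \<open>(I - d w) (I + d w)\<close>, and
  \<open>I - d w = (1 - d) (T\<^sup>2 + \<mu> I) (T\<^sup>2 + I)\<^sup>-\<^sup>1\<close> with \<open>\<mu> = (1 + d) / (1 - d)\<close> in the right half-plane.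
  Finally \<open>T\<^sup>2 + \<mu> I = (T - i \<nu>) (T + i \<nu>)\<close> with \<open>\<nu> = \<surd>\<mu>\<close>, and the two points \<open>i \<nu>\<close> and \<open>- i \<nu>\<close>
  are separated from the sector by the lines that bound it. Separation by a line makes a
  complex multiple of \<open>T - \<kappa> I\<close> coercive, and coercive operators are invertible
  (lemma \<open>invertible_coercive\<close>).
\<close>

section \<open>Complex inner products\<close>

lemma cinner_add_right: "cinner x (y + z) = cinner x y + cinner (x::'a::complex_inner) z"
  by (metis cinner_add_left cinner_commute complex_cnj_add)

lemma cinner_scaleC_right: "cinner x (c *\<^sub>C y) = cnj c * cinner (x::'a::complex_inner) y"
  by (metis cinner_commute cinner_scaleC_left complex_cnj_mult)

lemma scaleC_zero_left [simp]: "0 *\<^sub>C x = (0::'a::complex_vector)"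
  using scaleR_scaleC[of 0 x] by simp

lemma scaleC_zero_right [simp]: "c *\<^sub>C 0 = (0::'a::complex_vector)"
  using scaleC_add_right[of c 0 "0::'a"] by simp

lemma scaleC_minus_right: "c *\<^sub>C (- x) = - (c *\<^sub>C (x::'a::complex_vector))"
  using scaleC_add_right[of c x "-x"] by (simp add: eq_neg_iff_add_eq_0 add.commute)

lemma scaleC_minus_left: "(- c) *\<^sub>C x = - (c *\<^sub>C (x::'a::complex_vector))"
  using scaleC_add_left[of c "-c" x] by (simp add: eq_neg_iff_add_eq_0 add.commute)

lemma scaleC_diff_right: "c *\<^sub>C (x - y) = c *\<^sub>C x - c *\<^sub>C (y::'a::complex_vector)"
  using scaleC_add_right[of c x "-y"] by (simp add: scaleC_minus_right)

lemma scaleC_diff_left: "(c - d) *\<^sub>C x = c *\<^sub>C x - d *\<^sub>C (x::'a::complex_vector)"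
  using scaleC_add_left[of c "-d" x] by (simp add: scaleC_minus_left)

lemma scaleC_scaleR: "c *\<^sub>C (r *\<^sub>R x) = r *\<^sub>R (c *\<^sub>C (x::'a::complex_vector))"
  by (simp add: scaleR_scaleC scaleC_scaleC mult.commute)

lemma cinner_diff_left: "cinner (x - y) z = cinner x z - cinner (y::'a::complex_inner) z"
  using cinner_add_left[of "x - y" y z] by simp

lemma norm_scaleC: "norm (c *\<^sub>C x) = cmod c * norm (x::'a::complex_inner)"
proof -
  have "complex_of_real ((norm (c *\<^sub>C x))\<^sup>2) = c * cnj c * complex_of_real ((norm x)\<^sup>2)"
    by (simp only: cinner_self[symmetric] cinner_scaleC_left cinner_scaleC_right mult_ac)
  also have "\<dots> = complex_of_real ((cmod c * norm x)\<^sup>2)"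
    by (simp add: complex_norm_square[symmetric] power_mult_distrib)
  finally have "(norm (c *\<^sub>C x))\<^sup>2 = (cmod c * norm x)\<^sup>2"
    using of_real_eq_iff by blast
  then show ?thesis
    by (simp add: power2_eq_iff_nonneg)
qed

lemma norm_add_square:
  "(norm (x + y))\<^sup>2 = (norm x)\<^sup>2 + (norm y)\<^sup>2 + 2 * Re (cinner (x::'a::complex_inner) y)"
proof -
  have "Re (cinner y x) = Re (cinner x y)"
    by (subst cinner_commute) simp
  moreover have "(norm z)\<^sup>2 = Re (cinner z z)" for z :: 'a
    by (simp add: cinner_self)
  ultimately show ?thesis
    by (simp add: cinner_add_left cinner_add_right)
qed

text \<open>
  The vector \<open>\<langle>x, \<xi>\<rangle> \<xi>\<close> is the orthogonal projection of \<open>x\<close> onto the line of \<open>\<xi>\<close>, so this is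
  Pythagoras; since the left side is nonnegative, it contains Cauchy--Schwarz for a unit vector.
\<close>

lemma norm_diff_projection:
  assumes "norm \<xi> = 1"
  shows "(norm (x - cinner x \<xi> *\<^sub>C \<xi>))\<^sup>2 = (norm (x::'a::complex_inner))\<^sup>2 - (cmod (cinner x \<xi>))\<^sup>2"
proof -
  let ?q = "cinner x \<xi>"
  have "(norm (x + (- ?q) *\<^sub>C \<xi>))\<^sup>2 = (norm x)\<^sup>2 + (cmod ?q)\<^sup>2 - 2 * Re (cnj ?q * ?q)"
    unfolding norm_add_square by (simp add: norm_scaleC assms cinner_scaleC_right)
  also have "Re (cnj ?q * ?q) = (cmod ?q)\<^sup>2"
    unfolding cmod_power2 by (simp add: power2_eq_square)
  finally show ?thesis
    by (simp add: scaleC_minus_left)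
qed

section \<open>Invertible operators\<close>

text \<open>
  Boundedness of the inverse is made part of the notion: it is what makes the operator norm of a
  quotient \<open>A B\<^sup>-\<^sup>1\<close> meaningful, and in the lemmas below it comes from explicit lower bounds
  rather than from the open mapping theorem.
\<close>

definition invertible_clinear :: "('a::complex_inner \<Rightarrow> 'a) \<Rightarrow> bool" where
  "invertible_clinear A \<longleftrightarrow> bounded_clinear A \<and>
    (\<exists>B. bounded_clinear B \<and> (\<forall>x. B (A x) = x) \<and> (\<forall>x. A (B x) = x))"

lemma bounded_clinear_compose:
  "bounded_clinear A \<Longrightarrow> bounded_clinear B \<Longrightarrow> bounded_clinear (\<lambda>x. A (B x))"
  unfolding bounded_clinear_def by (simp add: bounded_linear_compose[of A B])

lemma bounded_clinear_add:
  "bounded_clinear A \<Longrightarrow> bounded_clinear B \<Longrightarrow> bounded_clinear (\<lambda>x. A x + B x)"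
  unfolding bounded_clinear_def by (simp add: bounded_linear_add scaleC_add_right)

lemma bounded_clinear_diff:
  "bounded_clinear A \<Longrightarrow> bounded_clinear B \<Longrightarrow> bounded_clinear (\<lambda>x. A x - B x)"
  unfolding bounded_clinear_def by (simp add: bounded_linear_sub scaleC_diff_right)

lemma bounded_clinear_ident: "bounded_clinear (\<lambda>x. x)"
  unfolding bounded_clinear_def by simp

lemma bounded_clinear_scaleC: "bounded_clinear (\<lambda>x::'a::complex_inner. c *\<^sub>C x)"
  unfolding bounded_clinear_def
proof (intro conjI allI)
  show "bounded_linear (\<lambda>x::'a. c *\<^sub>C x)"
    by (rule bounded_linear_intro[where K = "cmod c"])
      (auto simp: scaleC_add_right scaleC_scaleR norm_scaleC)
qed (simp add: scaleC_scaleC mult.commute)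

lemmas bounded_clinear_intros = bounded_clinear_add bounded_clinear_diff bounded_clinear_ident
  bounded_clinear_compose[OF bounded_clinear_scaleC]

lemma invertible_clinear_bounded: "invertible_clinear A \<Longrightarrow> bounded_clinear A"
  by (simp add: invertible_clinear_def)

lemma invertible_clinear_inv:
  assumes "invertible_clinear A"
  shows "invertible_clinear (inv A)" "inv A (A x) = x" "A (inv A x) = x"
proof -
  obtain B where A: "bounded_clinear A" and B: "bounded_clinear B" "\<And>x. B (A x) = x" "\<And>x. A (B x) = x"
    using assms unfolding invertible_clinear_def by blast
  then have "inv A = B"
    by (metis inv_equality)
  with A B show "invertible_clinear (inv A)" "inv A (A x) = x" "A (inv A x) = x"
    unfolding invertible_clinear_def by auto
qed

lemma invertible_clinear_compose:
  assumes "invertible_clinear A" "invertible_clinear B"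
  shows "invertible_clinear (\<lambda>x. A (B x))"
proof -
  have "bounded_clinear (\<lambda>x. inv B (inv A x))" "bounded_clinear (\<lambda>x. A (B x))"
    using assms by (simp_all add: bounded_clinear_compose invertible_clinear_bounded
        invertible_clinear_inv(1))
  then show ?thesis
    unfolding invertible_clinear_def
    by (intro conjI exI[of _ "\<lambda>x. inv B (inv A x)"])
      (simp_all add: invertible_clinear_inv(2,3) assms)
qed

lemma invertible_clinear_scaleC:
  assumes "c \<noteq> 0"
  shows "invertible_clinear (\<lambda>x::'a::complex_inner. c *\<^sub>C x)"
  unfolding invertible_clinear_def
  using assms by (intro conjI exI[of _ "\<lambda>x. inverse c *\<^sub>C x"])
    (auto simp: scaleC_scaleC scaleC_one bounded_clinear_scaleC)

text \<open>
  The equation \<open>F x = y\<close> says that \<open>x\<close> is a fixed point of the contraction \<open>x \<mapsto> x - F x + y\<close>, so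
  Banach's theorem provides a unique solution. The triangle inequality gives
  \<open>(1 - \<theta>) \<parallel>x\<parallel> \<le> \<parallel>F x\<parallel>\<close>, which bounds the inverse.
\<close>

lemma invertible_near_identity:
  fixes F :: "'a::chilbert_space \<Rightarrow> 'a"
  assumes F: "bounded_clinear F"
    and near: "\<And>x. norm (x - F x) \<le> \<theta> * norm x" and "0 \<le> \<theta>" "\<theta> < 1"
  shows "invertible_clinear F"
proof -
  interpret F: bounded_linear F
    using F by (simp add: bounded_clinear_def)
  have FC: "F (c *\<^sub>C x) = c *\<^sub>C F x" for c x
    using F by (simp add: bounded_clinear_def)
  have "\<exists>!x. x - F x + y = x" for y
  proof (rule banach_fix_type[OF \<open>0 \<le> \<theta>\<close> \<open>\<theta> < 1\<close>, rule_format])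
    fix u v
    have "dist (u - F u + y) (v - F v + y) = norm ((u - v) - F (u - v))"
      by (simp add: dist_norm F.diff algebra_simps)
    then show "dist (u - F u + y) (v - F v + y) \<le> \<theta> * dist u v"
      using near[of "u - v"] by (simp add: dist_norm)
  qed
  moreover have "x - F x + y = x \<longleftrightarrow> F x = y" for x y
    by (auto simp: algebra_simps)
  ultimately have ex1: "\<exists>!x. F x = y" for y
    by simp
  define B where "B y = (THE x. F x = y)" for y
  have FB: "F (B y) = y" for y
    unfolding B_def using theI'[OF ex1] .
  have inj: "u = v" if "F u = F v" for u v
    using that ex1 by metis
  have below: "(1 - \<theta>) * norm x \<le> norm (F x)" for x
    using near[of x] norm_triangle_ineq2[of x "x - F x"] by (simp add: algebra_simps)
  have "bounded_linear B"
  proof (rule bounded_linear_intro[where K = "1 / (1 - \<theta>)"])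
    show "norm (B x) \<le> norm x * (1 / (1 - \<theta>))" for x
      using below[of "B x"] \<open>\<theta> < 1\<close> by (simp add: FB field_simps)
  qed (rule inj; simp add: FB F.add F.scaleR)+
  moreover have "B (c *\<^sub>C x) = c *\<^sub>C B x" for c x
    by (rule inj) (simp add: FB FC)
  moreover have BF: "B (F x) = x" for x
    by (rule inj) (simp add: FB)
  ultimately show ?thesis
    unfolding invertible_clinear_def bounded_clinear_def using F
    by (intro conjI exI[of _ B]) (auto simp: FB BF bounded_clinear_def)
qed

text \<open>
  This is the Lax--Milgram theorem, by Zarantonello's argument: for small \<open>t > 0\<close> the operator
  \<open>t A\<close> is near the identity, because
  \<open>\<parallel>x - t A x\<parallel>\<^sup>2 \<le> (1 - 2 t \<delta> + t\<^sup>2 M\<^sup>2) \<parallel>x\<parallel>\<^sup>2\<close> when \<open>M\<close> bounds \<open>A\<close>.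
\<close>

lemma invertible_coercive:
  fixes A :: "'a::chilbert_space \<Rightarrow> 'a"
  assumes A: "bounded_clinear A" and "\<delta> > 0"
    and coercive: "\<And>x. \<delta> * (norm x)\<^sup>2 \<le> Re (cinner (A x) x)"
  shows "invertible_clinear A"
proof -
  obtain M where M: "M > 0" "\<And>x. norm (A x) \<le> norm x * M"
    using A bounded_linear.pos_bounded unfolding bounded_clinear_def by metis
  have M2: "(norm (A x))\<^sup>2 \<le> M\<^sup>2 * (norm x)\<^sup>2" for x
    using power_mono[OF M(2)[of x], of 2] by (simp add: power_mult_distrib mult.commute)
  \<comment> \<open>The choice \<open>t = \<delta> / K\<close> turns the factor above into at most \<open>1 - t \<delta>\<close>. The summand \<open>\<delta>\<^sup>2\<close> of \<open>K\<close>
    makes \<open>t \<delta> \<le> 1\<close> evident, without a comparison of \<open>\<delta>\<close> and \<open>M\<close>.\<close>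
  define K where "K = M\<^sup>2 + \<delta>\<^sup>2"
  define t where "t = \<delta> / K"
  have "K > 0" and "t > 0"
    using \<open>\<delta> > 0\<close> by (auto simp: K_def t_def intro!: add_nonneg_pos divide_pos_pos)
  have tK: "t * K = \<delta>"
    using \<open>K > 0\<close> by (simp add: t_def)
  have t\<delta>: "t * \<delta> > 0" "t * \<delta> \<le> 1"
    using \<open>t > 0\<close> \<open>\<delta> > 0\<close> \<open>K > 0\<close> by (auto simp: t_def K_def field_simps power2_eq_square)
  define \<theta> where "\<theta> = sqrt (1 - t * \<delta>)"
  have \<theta>: "0 \<le> \<theta>" "\<theta> < 1" "\<theta>\<^sup>2 = 1 - t * \<delta>"
    using t\<delta> by (auto simp: \<theta>_def)
  have "invertible_clinear (\<lambda>x. complex_of_real t *\<^sub>C A x)"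
  proof (rule invertible_near_identity)
    show "bounded_clinear (\<lambda>x. complex_of_real t *\<^sub>C A x)"
      using A by (intro bounded_clinear_intros)
  next
    fix x
    have "Re (cinner x (A x)) = Re (cinner (A x) x)"
      by (subst cinner_commute) simp
    then have "(norm (x + complex_of_real (- t) *\<^sub>C A x))\<^sup>2
        = (norm x)\<^sup>2 + t\<^sup>2 * (norm (A x))\<^sup>2 - 2 * t * Re (cinner (A x) x)"
      unfolding norm_add_square by (simp add: norm_scaleC cinner_scaleC_right power_mult_distrib)
    moreover have "t\<^sup>2 * (norm (A x))\<^sup>2 \<le> t\<^sup>2 * (K * (norm x)\<^sup>2)"
    proof (rule mult_left_mono)
      show "(norm (A x))\<^sup>2 \<le> K * (norm x)\<^sup>2"
        using M2[of x] by (simp add: K_def distrib_right add_increasing2)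
    qed simp
    moreover have "t\<^sup>2 * (K * (norm x)\<^sup>2) = t * \<delta> * (norm x)\<^sup>2"
      by (simp add: power2_eq_square flip: tK)
    moreover have "t * \<delta> * (norm x)\<^sup>2 \<le> t * Re (cinner (A x) x)"
      using coercive[of x] \<open>t > 0\<close> by (simp add: mult.assoc)
    moreover have "\<theta>\<^sup>2 * (norm x)\<^sup>2 = (norm x)\<^sup>2 - t * \<delta> * (norm x)\<^sup>2"
      by (simp add: \<theta>(3) left_diff_distrib)
    ultimately have "(norm (x + complex_of_real (- t) *\<^sub>C A x))\<^sup>2 \<le> \<theta>\<^sup>2 * (norm x)\<^sup>2"
      by linarith
    then have "(norm (x - complex_of_real t *\<^sub>C A x))\<^sup>2 \<le> (\<theta> * norm x)\<^sup>2"
      by (simp add: power_mult_distrib scaleC_minus_left)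
    then show "norm (x - complex_of_real t *\<^sub>C A x) \<le> \<theta> * norm x"
      by (rule power2_le_imp_le) (use \<theta>(1) in simp)
  qed (use \<theta> in auto)
  then have "invertible_clinear (\<lambda>x. complex_of_real (inverse t) *\<^sub>C complex_of_real t *\<^sub>C A x)"
    by (rule invertible_clinear_compose[rotated]) (use \<open>t > 0\<close> in \<open>simp add: invertible_clinear_scaleC\<close>)
  moreover have "complex_of_real (inverse t) * complex_of_real t = 1"
    using \<open>t > 0\<close> by simp
  ultimately show ?thesis
    by (simp only: scaleC_scaleC scaleC_one)
qed

section \<open>Operators with numerical range in a sector\<close>

text \<open>
  The sector of half-angle \<open>\<pi> / 4\<close> is the intersection of two half-planes; this is the only form in
  which it is used.
\<close>

lemma sector_quarter_pi:
  assumes "z \<in> sector (pi / 4)"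
  shows "\<bar>Im z\<bar> \<le> Re z"
proof -
  obtain r \<theta> where z: "z = complex_of_real r * cis \<theta>" and r: "0 \<le> r" and \<theta>: "\<bar>\<theta>\<bar> \<le> pi / 4"
    using assms by (auto simp: sector_def)
  have "sin \<bar>\<theta>\<bar> \<le> sin (pi / 4)"
    by (rule sin_monotone_2pi_le) (use \<theta> pi_gt_zero in linarith)+
  moreover have "cos (pi / 4) \<le> cos \<bar>\<theta>\<bar>"
    by (rule cos_monotone_0_pi_le) (use \<theta> pi_gt_zero in linarith)+
  moreover have "0 \<le> sin \<bar>\<theta>\<bar>"
    by (rule sin_ge_zero) (use \<theta> pi_gt_zero in linarith)+
  ultimately have "\<bar>sin \<theta>\<bar> \<le> cos \<theta>"
    by (auto simp: sin_45 cos_45 abs_if split: if_splits)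
  then show ?thesis
    using r by (simp add: z abs_mult mult_left_mono)
qed

lemma numerical_range_sector:
  assumes "bounded_clinear T" "numerical_range T \<subseteq> sector (pi / 4)"
  shows "\<bar>Im (cinner (T x) x)\<bar> \<le> Re (cinner (T x) x)"
proof (cases "x = 0")
  case True
  have "cinner y 0 = 0" for y :: 'a
    using cinner_scaleC_right[of y 0 0] by simp
  then show ?thesis
    using True by simp
next
  case False
  define u where "u = complex_of_real (1 / norm x) *\<^sub>C x"
  have "norm u = 1" and x: "x = complex_of_real (norm x) *\<^sub>C u"
    using False by (auto simp: u_def norm_scaleC scaleC_scaleC scaleC_one norm_divide)
  then have "\<bar>Im (cinner (T u) u)\<bar> \<le> Re (cinner (T u) u)"
    using assms(2) by (auto simp: numerical_range_def intro!: sector_quarter_pi)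
  moreover have "cinner (T x) x = complex_of_real ((norm x)\<^sup>2) * cinner (T u) u"
    using assms(1) by (subst (1 2) x)
      (simp add: bounded_clinear_def cinner_scaleC_left cinner_scaleC_right power2_eq_square)
  ultimately show ?thesis
    by (simp add: abs_mult mult_left_mono)
qed

text \<open>
  If the numerical range lies in the half-plane \<open>Re (a z) \<ge> 0\<close> and \<open>\<kappa>\<close> lies strictly outside it, then
  \<open>a (T - \<kappa> I)\<close> is coercive with constant \<open>- Re (a \<kappa>)\<close>.
\<close>

lemma invertible_minus_scalar_halfplane:
  fixes T :: "'a::chilbert_space \<Rightarrow> 'a"
  assumes T: "bounded_clinear T" and "\<And>x. 0 \<le> Re (a * cinner (T x) x)"
    and "Re (a * \<kappa>) < 0"
  shows "invertible_clinear (\<lambda>x. T x - \<kappa> *\<^sub>C x)"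
proof -
  have "a \<noteq> 0"
    using assms(3) by auto
  have "invertible_clinear (\<lambda>x. a *\<^sub>C (T x - \<kappa> *\<^sub>C x))"
  proof (rule invertible_coercive)
    show "bounded_clinear (\<lambda>x. a *\<^sub>C (T x - \<kappa> *\<^sub>C x))"
      using T by (intro bounded_clinear_intros)
    show "0 < - Re (a * \<kappa>)"
      using assms(3) by simp
    fix x
    have "cinner (a *\<^sub>C (T x - \<kappa> *\<^sub>C x)) x = a * cinner (T x) x - a * \<kappa> * complex_of_real ((norm x)\<^sup>2)"
      by (simp add: cinner_scaleC_left cinner_diff_left cinner_self right_diff_distrib)
    then have "Re (cinner (a *\<^sub>C (T x - \<kappa> *\<^sub>C x)) x)
        = Re (a * cinner (T x) x) - Re (a * \<kappa>) * (norm x)\<^sup>2"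
      by simp
    then show "- Re (a * \<kappa>) * (norm x)\<^sup>2 \<le> Re (cinner (a *\<^sub>C (T x - \<kappa> *\<^sub>C x)) x)"
      using assms(2)[of x] by linarith
  qed
  from invertible_clinear_compose[OF invertible_clinear_scaleC[of "inverse a"] this]
  show ?thesis
    using \<open>a \<noteq> 0\<close> by (simp add: scaleC_scaleC scaleC_one)
qed

text \<open>
  The factors of \<open>T\<^sup>2 + \<mu> I\<close> are \<open>T - i \<nu>\<close> and \<open>T + i \<nu>\<close> for the principal root \<open>\<nu>\<close> of \<open>\<mu>\<close>.
  Since \<open>Re \<mu> > 0\<close>, the argument of \<open>\<nu>\<close> is less than \<open>\<pi> / 4\<close> in absolute value, so \<open>i \<nu>\<close> lies
  strictly above the sector and \<open>- i \<nu>\<close> strictly below it.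
\<close>

lemma invertible_square_plus:
  fixes T :: "'a::chilbert_space \<Rightarrow> 'a"
  assumes T: "bounded_clinear T" and sector: "\<And>x. \<bar>Im (cinner (T x) x)\<bar> \<le> Re (cinner (T x) x)"
    and "Re \<mu> > 0"
  shows "invertible_clinear (\<lambda>x. T (T x) + \<mu> *\<^sub>C x)"
proof -
  define \<nu> where "\<nu> = csqrt \<mu>"
  have "(Re \<nu>)\<^sup>2 - (Im \<nu>)\<^sup>2 = Re (\<nu>\<^sup>2)"
    by (simp add: power2_eq_square)
  also have "\<nu>\<^sup>2 = \<mu>"
    by (simp add: \<nu>_def)
  finally have "\<bar>Im \<nu>\<bar>\<^sup>2 < (Re \<nu>)\<^sup>2"
    using \<open>Re \<mu> > 0\<close> by simp
  then have \<nu>: "\<bar>Im \<nu>\<bar> < Re \<nu>"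
    by (rule power2_less_imp_less) (use Re_csqrt[of \<mu>] in \<open>simp only: \<nu>_def\<close>)
  \<comment> \<open>\<open>Re ((1 + i) z) = Re z - Im z\<close> and \<open>Re ((1 - i) z) = Re z + Im z\<close>\<close>
  have halfplanes: "0 \<le> Re ((1 + \<i>) * cinner (T x) x)" "0 \<le> Re ((1 - \<i>) * cinner (T x) x)" for x
    using sector[of x] by (auto simp: abs_le_iff)
  have "invertible_clinear (\<lambda>x. T x - (\<i> * \<nu>) *\<^sub>C x)"
    by (rule invertible_minus_scalar_halfplane[OF T halfplanes(1)]) (use \<nu> in auto)
  moreover have "invertible_clinear (\<lambda>x. T x - (- \<i> * \<nu>) *\<^sub>C x)"
    by (rule invertible_minus_scalar_halfplane[OF T halfplanes(2)]) (use \<nu> in auto)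
  ultimately have "invertible_clinear (\<lambda>x. T (T x - (- \<i> * \<nu>) *\<^sub>C x) - (\<i> * \<nu>) *\<^sub>C (T x - (- \<i> * \<nu>) *\<^sub>C x))"
    by (rule invertible_clinear_compose)
  moreover have "T (T x - (- \<i> * \<nu>) *\<^sub>C x) - (\<i> * \<nu>) *\<^sub>C (T x - (- \<i> * \<nu>) *\<^sub>C x) = T (T x) + \<mu> *\<^sub>C x" for x
  proof -
    interpret T: bounded_linear T
      using T by (simp add: bounded_clinear_def)
    have "(\<i> * \<nu>) * (\<i> * \<nu>) = - \<mu>"
      by (simp add: \<nu>_def algebra_simps flip: power2_eq_square)
    then show ?thesis
      using T by (simp add: T.add T.diff bounded_clinear_def scaleC_minus_left scaleC_diff_right
          scaleC_add_right scaleC_scaleC)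
  qed
  ultimately show ?thesis
    by simp
qed

text \<open>
  The spectrum of \<open>T\<^sup>2\<close> lies in the right half-plane, so its Cayley transform has spectrum in the
  closed unit disc. Concretely, for \<open>x = (T\<^sup>2 + I) z\<close> the vector \<open>x - d w x\<close> equals
  \<open>(1 - d) (T\<^sup>2 z + \<mu> z)\<close>, where \<open>\<mu> = (1 + d) / (1 - d)\<close> has positive real part as \<open>\<bar>d\<bar> < 1\<close>.
\<close>

lemma invertible_one_minus_cayley_square:
  fixes T :: "'a::chilbert_space \<Rightarrow> 'a"
  assumes T: "bounded_clinear T" and sector: "\<And>x. \<bar>Im (cinner (T x) x)\<bar> \<le> Re (cinner (T x) x)"
    and d: "cmod d < 1"
  shows "invertible_clinear (\<lambda>x. x - d *\<^sub>C cayley_square T x)"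
proof -
  define S where "S x = T (T x) + x" for x
  define \<mu> where "\<mu> = (1 + d) / (1 - d)"
  have "d \<noteq> 1"
    using d by auto
  have S: "invertible_clinear S"
    using invertible_square_plus[OF T sector, of 1] by (simp add: S_def[abs_def] scaleC_one)
  have "Re \<mu> = (1 - (cmod d)\<^sup>2) / (cmod (1 - d))\<^sup>2"
    by (simp add: \<mu>_def Re_divide cmod_power2) (simp add: power2_eq_square algebra_simps)
  moreover have "(cmod d)\<^sup>2 < 1"
    using d by (simp add: power_less_one_iff abs_square_less_1)
  ultimately have "Re \<mu> > 0"
    using \<open>d \<noteq> 1\<close> by simp
  then have "invertible_clinear (\<lambda>x. (1 - d) *\<^sub>C (T (T (inv S x)) + \<mu> *\<^sub>C inv S x))"
    using \<open>d \<noteq> 1\<close> invertible_clinear_compose[OF invertible_clinear_scaleC[of "1 - d"]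
        invertible_clinear_compose[OF invertible_square_plus[OF T sector] invertible_clinear_inv(1)[OF S]]]
    by simp
  moreover have "(1 - d) *\<^sub>C (T (T z) + \<mu> *\<^sub>C z) = S z - d *\<^sub>C (T (T z) - z)" for z
  proof -
    have "(1 - d) * \<mu> = 1 + d"
      using \<open>d \<noteq> 1\<close> by (simp add: \<mu>_def)
    then show ?thesis
      by (simp add: S_def scaleC_add_right scaleC_diff_right scaleC_diff_left scaleC_scaleC
          scaleC_add_left scaleC_one)
  qed
  moreover have "cayley_square T x = T (T (inv S x)) - inv S x" for x
    by (simp add: cayley_square_def S_def[abs_def])
  ultimately show ?thesis
    by (simp add: invertible_clinear_inv(3)[OF S])
qed

lemma bounded_clinear_cayley_square:
  fixes T :: "'a::chilbert_space \<Rightarrow> 'a"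
  assumes T: "bounded_clinear T" and sector: "\<And>x. \<bar>Im (cinner (T x) x)\<bar> \<le> Re (cinner (T x) x)"
  shows "bounded_clinear (cayley_square T)"
proof -
  have "invertible_clinear (\<lambda>x. T (T x) + x)"
    using invertible_square_plus[OF T sector, of 1] by (simp add: scaleC_one)
  then have "bounded_clinear (inv (\<lambda>x. T (T x) + x))"
    by (intro invertible_clinear_bounded invertible_clinear_inv)
  moreover have "bounded_clinear (\<lambda>x. T (T x) - x)"
    by (intro bounded_clinear_diff bounded_clinear_compose[OF T T] bounded_clinear_ident)
  ultimately show ?thesis
    unfolding cayley_square_def comp_def by (rule bounded_clinear_compose[rotated])
qed

text \<open>
  With \<open>d\<^sup>2 = - c\<close> the operator factors as \<open>(I - d w) (I + d w)\<close>.
\<close>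

lemma invertible_one_plus_square:
  fixes w :: "'a::complex_inner \<Rightarrow> 'a"
  assumes w: "bounded_clinear w"
    and inv: "\<And>d. cmod d < 1 \<Longrightarrow> invertible_clinear (\<lambda>x. x - d *\<^sub>C w x)"
    and c: "cmod c < 1"
  shows "invertible_clinear (\<lambda>x. x + c *\<^sub>C w (w x))"
proof -
  interpret w: bounded_linear w
    using w by (simp add: bounded_clinear_def)
  define d where "d = csqrt (- c)"
  have d2: "d * d = - c"
    by (simp add: d_def flip: power2_eq_square)
  have "cmod d < 1"
    using c by (simp add: d_def norm_csqrt)
  then have "invertible_clinear (\<lambda>x. (x - (- d) *\<^sub>C w x) - d *\<^sub>C w (x - (- d) *\<^sub>C w x))"
    using invertible_clinear_compose[OF inv[of d] inv[of "- d"]] by simp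
  moreover have "(x - (- d) *\<^sub>C w x) - d *\<^sub>C w (x - (- d) *\<^sub>C w x) = x + c *\<^sub>C w (w x)" for x
    using w by (simp add: w.add w.diff bounded_clinear_def scaleC_minus_left scaleC_add_right
        scaleC_scaleC d2)
  ultimately show ?thesis
    by simp
qed

section \<open>The bound on a single vector\<close>

lemma onorm_quotient_le_iff:
  fixes A B :: "'a::complex_inner \<Rightarrow> 'a"
  assumes A: "bounded_clinear A" and B: "invertible_clinear B" and "0 \<le> K"
  shows "onorm (A \<circ> inv B) \<le> K \<longleftrightarrow> (\<forall>x. norm (A x) \<le> K * norm (B x))"
proof
  have "bounded_clinear (A \<circ> inv B)"
    unfolding comp_def
    by (rule bounded_clinear_compose[OF A invertible_clinear_bounded[OF invertible_clinear_inv(1)[OF B]]])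
  then have bl: "bounded_linear (A \<circ> inv B)"
    by (simp add: bounded_clinear_def)
  assume le: "onorm (A \<circ> inv B) \<le> K"
  show "\<forall>x. norm (A x) \<le> K * norm (B x)"
  proof
    fix x
    have "norm (A x) = norm ((A \<circ> inv B) (B x))"
      by (simp add: invertible_clinear_inv[OF B])
    also have "\<dots> \<le> onorm (A \<circ> inv B) * norm (B x)"
      by (rule onorm[OF bl])
    also have "\<dots> \<le> K * norm (B x)"
      using le by (rule mult_right_mono) simp
    finally show "norm (A x) \<le> K * norm (B x)" .
  qed
next
  assume "\<forall>x. norm (A x) \<le> K * norm (B x)"
  then show "onorm (A \<circ> inv B) \<le> K"
    using \<open>0 \<le> K\<close> by (intro onorm_bound) (metis comp_apply invertible_clinear_inv(3)[OF B])+
qed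

lemma all_iff_all_unit:
  fixes A B :: "'a::complex_inner \<Rightarrow> 'a"
  assumes A: "bounded_clinear A" and B: "bounded_clinear B"
  shows "(\<forall>x. norm (A x) \<le> K * norm (B x)) \<longleftrightarrow> (\<forall>x. norm x = 1 \<longrightarrow> norm (A x) \<le> K * norm (B x))"
proof (intro iffI allI impI)
  interpret A: bounded_linear A using A by (simp add: bounded_clinear_def)
  interpret B: bounded_linear B using B by (simp add: bounded_clinear_def)
  fix x
  assume unit: "\<forall>x. norm x = 1 \<longrightarrow> norm (A x) \<le> K * norm (B x)"
  show "norm (A x) \<le> K * norm (B x)"
  proof (cases "x = 0")
    case False
    then have "norm (A ((1 / norm x) *\<^sub>R x)) \<le> K * norm (B ((1 / norm x) *\<^sub>R x))"
      by (intro unit[rule_format]) simp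
    then show ?thesis
      using False by (simp add: A.scaleR B.scaleR divide_right_mono field_simps)
  qed (simp add: A.zero B.zero)
qed auto

text \<open>
  Both squared norms contain the same cross term \<open>2 Re (c \<langle>x, \<xi>\<rangle>)\<close>; the factor 2 on the right
  leaves one copy of it.
\<close>

lemma unit_vector_bound_iff:
  fixes x \<xi> :: "'a::complex_inner"
  assumes "norm \<xi> = 1"
  shows "norm (x + cnj c *\<^sub>C \<xi>) \<le> sqrt 2 * norm (\<xi> + c *\<^sub>C x) \<longleftrightarrow>
    0 \<le> 2 - (norm x)\<^sup>2 + (cmod c)\<^sup>2 * (2 * (norm x)\<^sup>2 - 1) + 2 * Re (c * cinner x \<xi>)"
proof -
  have "Re (cinner \<xi> (c *\<^sub>C x)) = Re (c * cinner x \<xi>)"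
    by (subst cinner_commute) (simp add: cinner_scaleC_left)
  then have "(norm (x + cnj c *\<^sub>C \<xi>))\<^sup>2 = (norm x)\<^sup>2 + (cmod c)\<^sup>2 + 2 * Re (c * cinner x \<xi>)"
    and "(norm (\<xi> + c *\<^sub>C x))\<^sup>2 = 1 + (cmod c)\<^sup>2 * (norm x)\<^sup>2 + 2 * Re (c * cinner x \<xi>)"
    unfolding norm_add_square using assms
    by (simp_all add: norm_scaleC cinner_scaleC_right power_mult_distrib)
  moreover have "norm (x + cnj c *\<^sub>C \<xi>) \<le> sqrt 2 * norm (\<xi> + c *\<^sub>C x) \<longleftrightarrow>
      (norm (x + cnj c *\<^sub>C \<xi>))\<^sup>2 \<le> 2 * (norm (\<xi> + c *\<^sub>C x))\<^sup>2"
    using abs_le_square_iff[of "norm (x + cnj c *\<^sub>C \<xi>)" "sqrt 2 * norm (\<xi> + c *\<^sub>C x)"]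
    by (simp add: power_mult_distrib abs_mult)
  ultimately show ?thesis
    by (auto simp: algebra_simps)
qed

text \<open>
  This is the minimisation over the disc. For \<open>b > 1\<close> the minimiser
  \<open>c = - cnj q / (2 b - 1)\<close> lies in the open disc because \<open>\<bar>q\<bar>\<^sup>2 \<le> b < (2 b - 1)\<^sup>2\<close>, and the minimum
  is \<open>2 - b - \<bar>q\<bar>\<^sup>2 / (2 b - 1)\<close>. For \<open>b \<le> 1\<close> put \<open>s = \<surd>b\<close> and \<open>r = \<bar>c\<bar>\<close>; the expression is at
  least \<open>2 - (r + s)\<^sup>2 + 2 (r s)\<^sup>2\<close>, and \<open>r + s \<le> 1 + r s\<close> on the unit square bounds that below by
  \<open>(1 - r s)\<^sup>2\<close>.
\<close>

lemma quadratic_on_disc_iff: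
  fixes b :: real and q :: complex
  assumes qb: "(cmod q)\<^sup>2 \<le> b"
  shows "(\<forall>c\<in>ball 0 1. 0 \<le> 2 - b + (cmod c)\<^sup>2 * (2 * b - 1) + 2 * Re (c * q)) \<longleftrightarrow>
    (b > 1 \<longrightarrow> (cmod q)\<^sup>2 \<le> (2 - b) * (2 * b - 1))"
proof (intro iffI impI ballI)
  assume nonneg: "\<forall>c\<in>ball 0 1. 0 \<le> 2 - b + (cmod c)\<^sup>2 * (2 * b - 1) + 2 * Re (c * q)"
    and b: "b > 1"
  define m where "m = 2 * b - 1"
  have m: "m > b" using b by (simp add: m_def)
  define c where "c = - cnj q / complex_of_real m"
  have norm_c: "(cmod c)\<^sup>2 = (cmod q)\<^sup>2 / m\<^sup>2"
    by (simp add: c_def norm_divide power_divide)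
  have "b < m\<^sup>2"
    using m b mult_strict_mono[of 1 m b m] by (simp add: power2_eq_square)
  then have "(cmod c)\<^sup>2 < 1"
    using qb m b by (simp add: norm_c)
  then have "c \<in> ball 0 1"
    by (simp add: abs_square_less_1)
  moreover have "Re (c * q) = - (cmod q)\<^sup>2 / m"
    unfolding c_def cmod_power2 using m b
    by (simp add: power2_eq_square Re_divide_of_real field_simps)
  ultimately have "0 \<le> 2 - b + (cmod q)\<^sup>2 / m\<^sup>2 * m + 2 * (- (cmod q)\<^sup>2 / m)"
    using nonneg norm_c by (metis m_def)
  also have "\<dots> = 2 - b - (cmod q)\<^sup>2 / m"
    using m b by (simp add: power2_eq_square)
  finally show "(cmod q)\<^sup>2 \<le> (2 - b) * (2 * b - 1)"
    unfolding m_def[symmetric] using m b by (simp add: field_simps)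
next
  fix c :: complex
  assume cond: "b > 1 \<longrightarrow> (cmod q)\<^sup>2 \<le> (2 - b) * (2 * b - 1)" and "c \<in> ball 0 1"
  define r where "r = cmod c"
  have r: "0 \<le> r" "r < 1"
    using \<open>c \<in> ball 0 1\<close> by (auto simp: r_def)
  have "\<bar>Re (c * q)\<bar> \<le> r * cmod q"
    using abs_Re_le_cmod[of "c * q"] by (simp add: norm_mult r_def)
  then have phase: "- (r * cmod q) \<le> Re (c * q)"
    by linarith
  have "0 \<le> 2 - b + r\<^sup>2 * (2 * b - 1) - 2 * (r * cmod q)"
  proof (cases "b > 1")
    case True
    define m where "m = 2 * b - 1"
    have "m > 0" using True by (simp add: m_def)
    \<comment> \<open>completing the square in \<open>r\<close>\<close>
    have "0 \<le> (m * r - cmod q)\<^sup>2 + ((2 - b) * m - (cmod q)\<^sup>2)"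
      using cond True by (simp add: m_def)
    also have "\<dots> = m * (2 - b + r\<^sup>2 * m - 2 * (r * cmod q))"
      by (simp add: algebra_simps power2_eq_square)
    finally show ?thesis
      using \<open>m > 0\<close> by (simp add: zero_le_mult_iff m_def)
  next
    case False
    define s where "s = sqrt b"
    have b0: "0 \<le> b"
      using qb by (meson order_trans zero_le_power2)
    have s: "0 \<le> s" "s \<le> 1" "b = s\<^sup>2" "cmod q \<le> s"
      using False qb b0 by (auto simp: s_def real_le_rsqrt)
    have "0 \<le> (1 - r) * (1 - s)"
      using r s by simp
    then have "r + s \<le> 1 + r * s"
      by (simp add: algebra_simps)
    then have "(r + s)\<^sup>2 \<le> (1 + r * s)\<^sup>2"
      using r s by (intro power_mono) auto
    moreover have "0 \<le> (1 - r * s)\<^sup>2"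
      by simp
    ultimately have "0 \<le> 2 - (r + s)\<^sup>2 + 2 * (r * s)\<^sup>2"
      by (simp add: algebra_simps power2_eq_square)
    also have "\<dots> = 2 - b + r\<^sup>2 * (2 * b - 1) - 2 * (r * s)"
      by (simp add: s(3) algebra_simps power2_eq_square)
    also have "\<dots> \<le> 2 - b + r\<^sup>2 * (2 * b - 1) - 2 * (r * cmod q)"
      using r s by (simp add: mult_left_mono)
    finally show ?thesis .
  qed
  then show "0 \<le> 2 - b + (cmod c)\<^sup>2 * (2 * b - 1) + 2 * Re (c * q)"
    using phase by (simp add: r_def)
qed

theorem proposition6p7:
  fixes T w X :: "'a::chilbert_space \<Rightarrow> 'a"
    and b :: "'a \<Rightarrow> real" and q :: "'a \<Rightarrow> complex"
  assumes "bounded_clinear T"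
    and "numerical_range T \<subseteq> sector (pi / 4)"
    and "w = cayley_square T"
    and "X = w \<circ> w"
    and "b = (\<lambda>\<xi>. (norm (X \<xi>))\<^sup>2)"
    and "q = (\<lambda>\<xi>. cinner (X \<xi>) \<xi>)"
  shows "((\<forall>c\<in>ball 0 1. onorm (h_op c w) \<le> sqrt 2) \<longleftrightarrow>
          (\<forall>\<xi>. norm \<xi> = 1 \<longrightarrow> b \<xi> > 1 \<longrightarrow> (cmod (q \<xi>))\<^sup>2 \<le> (2 - b \<xi>) * (2 * b \<xi> - 1)))
       \<and> ((\<forall>\<xi>. norm \<xi> = 1 \<longrightarrow> b \<xi> > 1 \<longrightarrow> (cmod (q \<xi>))\<^sup>2 \<le> (2 - b \<xi>) * (2 * b \<xi> - 1)) \<longleftrightarrow>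
          (\<forall>\<xi>. norm \<xi> = 1 \<longrightarrow> norm (X \<xi>) > 1 \<longrightarrow>
             (norm (X \<xi> - q \<xi> *\<^sub>C \<xi>))\<^sup>2 \<ge> 2 * ((norm (X \<xi>))\<^sup>2 - 1)\<^sup>2))"
proof -
  note sector = numerical_range_sector[OF assms(1,2)]
  have w: "bounded_clinear w"
    unfolding assms(3) by (rule bounded_clinear_cayley_square[OF assms(1) sector])
  then have X: "bounded_clinear X"
    unfolding assms(4) comp_def by (rule bounded_clinear_compose[OF w])
  have residual: "(norm (X \<xi> - q \<xi> *\<^sub>C \<xi>))\<^sup>2 = b \<xi> - (cmod (q \<xi>))\<^sup>2" if "norm \<xi> = 1" for \<xi>
    using norm_diff_projection[OF that, of "X \<xi>"] by (simp add: assms(5,6))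
  have qb: "(cmod (q \<xi>))\<^sup>2 \<le> b \<xi>" if "norm \<xi> = 1" for \<xi>
    using residual[OF that] zero_le_power2[of "norm (X \<xi> - q \<xi> *\<^sub>C \<xi>)"] by linarith
  have "onorm (h_op c w) \<le> sqrt 2 \<longleftrightarrow> (\<forall>\<xi>. norm \<xi> = 1 \<longrightarrow>
      0 \<le> 2 - b \<xi> + (cmod c)\<^sup>2 * (2 * b \<xi> - 1) + 2 * Re (c * q \<xi>))" if "c \<in> ball 0 1" for c
  proof -
    have inv: "invertible_clinear (\<lambda>x. x + c *\<^sub>C X x)"
      using invertible_one_plus_square[OF w, of c] that
        invertible_one_minus_cayley_square[OF assms(1) sector]
      by (simp add: assms(3,4))
    have num: "bounded_clinear (\<lambda>x. X x + cnj c *\<^sub>C x)"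
      using X by (intro bounded_clinear_intros)
    have h: "h_op c w = (\<lambda>x. X x + cnj c *\<^sub>C x) \<circ> inv (\<lambda>x. x + c *\<^sub>C X x)"
      by (simp add: h_op_def assms(4))
    have "onorm (h_op c w) \<le> sqrt 2 \<longleftrightarrow>
        (\<forall>x. norm (X x + cnj c *\<^sub>C x) \<le> sqrt 2 * norm (x + c *\<^sub>C X x))"
      unfolding h by (rule onorm_quotient_le_iff[OF num inv]) simp
    also have "\<dots> \<longleftrightarrow>
        (\<forall>x. norm x = 1 \<longrightarrow> norm (X x + cnj c *\<^sub>C x) \<le> sqrt 2 * norm (x + c *\<^sub>C X x))"
      by (rule all_iff_all_unit[OF num invertible_clinear_bounded[OF inv]])
    also have "\<dots> \<longleftrightarrow> (\<forall>\<xi>. norm \<xi> = 1 \<longrightarrow>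
        0 \<le> 2 - b \<xi> + (cmod c)\<^sup>2 * (2 * b \<xi> - 1) + 2 * Re (c * q \<xi>))"
      by (simp add: unit_vector_bound_iff assms(5,6))
    finally show ?thesis .
  qed
  then have "(\<forall>c\<in>ball 0 1. onorm (h_op c w) \<le> sqrt 2) \<longleftrightarrow> (\<forall>\<xi>. norm \<xi> = 1 \<longrightarrow>
      (\<forall>c\<in>ball 0 1. 0 \<le> 2 - b \<xi> + (cmod c)\<^sup>2 * (2 * b \<xi> - 1) + 2 * Re (c * q \<xi>)))"
    by blast
  also have "\<dots> \<longleftrightarrow>
      (\<forall>\<xi>. norm \<xi> = 1 \<longrightarrow> b \<xi> > 1 \<longrightarrow> (cmod (q \<xi>))\<^sup>2 \<le> (2 - b \<xi>) * (2 * b \<xi> - 1))"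
    using quadratic_on_disc_iff[OF qb] by blast
  finally have first: "(\<forall>c\<in>ball 0 1. onorm (h_op c w) \<le> sqrt 2) \<longleftrightarrow>
      (\<forall>\<xi>. norm \<xi> = 1 \<longrightarrow> b \<xi> > 1 \<longrightarrow> (cmod (q \<xi>))\<^sup>2 \<le> (2 - b \<xi>) * (2 * b \<xi> - 1))" .
  have "norm (X \<xi>) > 1 \<longleftrightarrow> b \<xi> > 1" for \<xi>
    using abs_square_le_1[of "norm (X \<xi>)"] by (auto simp: assms(5) not_le[symmetric])
  moreover have "2 * ((norm (X \<xi>))\<^sup>2 - 1)\<^sup>2 \<le> (norm (X \<xi> - q \<xi> *\<^sub>C \<xi>))\<^sup>2 \<longleftrightarrow>
      (cmod (q \<xi>))\<^sup>2 \<le> (2 - b \<xi>) * (2 * b \<xi> - 1)" if "norm \<xi> = 1" for \<xi>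
  proof -
    have "(norm (X \<xi>))\<^sup>2 = b \<xi>"
      by (simp add: assms(5))
    moreover have "(2 - b \<xi>) * (2 * b \<xi> - 1) = b \<xi> - 2 * (b \<xi> - 1)\<^sup>2"
      by (simp add: algebra_simps power2_eq_square)
    ultimately show ?thesis
      unfolding residual[OF that] by auto
  qed
  ultimately show ?thesis
    by (intro conjI first) blast
qed

end
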